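(* Consider the adversarial reinforcement learning problem described in the context, with separable reward $r_c(x,u)=q_c(x)-g_c(u)$ and with the dynamics subject to an adversarial state disturbance $\xi_x$, $$\dot x=f_c(x,u,\xi_x)=a(x;\theta)+B(x;\theta)\,u+\xi_x ,$$ where the disturbance has bounded signal energy, i.e. the admissible set is $\Omega_E=\{\xi\in\mathbb{R}^n : \|\xi\|_2\le\alpha\}$. Then the optimal continuous-time policy $\pi$ and the optimal state disturbance $\xi_x$ are described by $$\pi(x)=\nabla\tilde g\big(B(x)^{T}\nabla_xV\big),\qquad \xi_x=-\alpha\,\frac{\nabla_xV}{\|\nabla_xV\|_2}.$$
   Context: Setting: $x$ is the state (in $\mathbb{R}^n$), $u$ the action, $\theta$ the system parameters, $a$ the non-linear drift and $B$ the non-linear control matrix, so that the deterministic continuous-time dynamics are non-linear in $x$ and affine in $u$; $B(x)$ abbreviates $B(x;\theta)$. The reward is $r_c(x,u)=q_c(x)-g_c(u)$, with state reward $q_c$ and action cost $g_c$ (also written $g$) that is non-linear, positive definite and strictly convex. $\tilde g$ is the convex conjugate of the action cost; its gradient is the inverse of the gradient of $g$, $\nabla\tilde g=[\nabla g]^{-1}$. Problem: the policy maximizes and the adversary minimizes the discounted reward, $$\max_{u}\ \inf_{\xi\in\Omega}\ \int_0^\infty \exp(-\rho t)\, r_c(x_t,u_t)\,dt,\qquad x(t)=x_0+\int_0^t f_c(x_\tau,u_\tau,\xi_\tau)\,d\tau,$$ with discounting constant $\rho\in(0,\infty]$. Policy and adversary are stationary and Markovian (deterministic functions of the state). The problem is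 treated by value iteration: given the current value function $V$, the next value target is $$V_{\mathrm{tar}}(x)=\max_u\ \inf_{\xi\in\Omega}\ r(x,u)+\gamma V\big(f(x,u,\xi)\big),$$ where $r$, $\gamma=\exp(-\rho\,\Delta t)$ and $f$ are the reward, discount factor and transition for time step $\Delta t$ corresponding to $r_c$, $\rho$ and $f_c$. The optimal continuous-time policy and disturbance are the action and disturbance solving this max-min problem in the continuous-time limit $\Delta t\to0$. $\nabla_xV$ denotes the gradient of $V$ with respect to the state, evaluated at $x$.
   Formalization: The discounting constant ρ is taken finite: at ρ=∞ the target ignores V, so the formulas fail. The disturbance formula is claimed only where ∇V≠0. The action cost g is finite and differentiable on R^m with invertible gradient, V is differentiable, and α≥0. *)

theory Defs
  imports "HOL-Analysis.Analysis"
begin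

text \<open>The gradient is a junk value where \<open>f\<close> is not differentiable.\<close>

definition gradient :: "('a::real_inner \<Rightarrow> real) \<Rightarrow> 'a \<Rightarrow> 'a" where
  "gradient f x = (THE D. GDERIV f x :> D)"

definition strictly_convex :: "('a::real_vector \<Rightarrow> real) \<Rightarrow> bool" where
  "strictly_convex f \<longleftrightarrow>
     (\<forall>x y t. x \<noteq> y \<and> 0 < t \<and> t < 1 \<longrightarrow>
        f ((1 - t) *\<^sub>R x + t *\<^sub>R y) < (1 - t) * f x + t * f y)"

definition positive_definite :: "('a::zero \<Rightarrow> real) \<Rightarrow> bool" where
  "positive_definite f \<longleftrightarrow> f 0 = 0 \<and> (\<forall>x. x \<noteq> 0 \<longrightarrow> f x > 0)"

text \<open>The supremum is taken in the reals.  It is only used for differentiable convex \<open>f\<close> whose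
  gradient map is onto; there the supremum is attained for every \<open>w\<close>.\<close>

definition convex_conjugate :: "('a::real_inner \<Rightarrow> real) \<Rightarrow> 'a \<Rightarrow> real" where
  "convex_conjugate f w = (SUP u. w \<bullet> u - f u)"

text \<open>A reward \<open>r h x u\<close> and a transition \<open>f h x u \<xi>\<close> for time step \<open>h\<close> correspond to the reward rate
  \<open>rc\<close> and to the vector field \<open>fc\<close> if they agree with them to first order in \<open>h\<close>, uniformly over
  the admissible disturbances.  This leaves open whether the transition is an Euler step or, for continuous
  coefficients, the exact flow with action and disturbance held constant over the step.\<close>

definition step_reward ::
  "(real \<Rightarrow> 'x \<Rightarrow> 'u \<Rightarrow> real) \<Rightarrow> ('x \<Rightarrow> 'u \<Rightarrow> real) \<Rightarrow> bool" where
  "step_reward r rc \<longleftrightarrow> (\<forall>x u. ((\<lambda>h. r h x u / h) \<longlongrightarrow> rc x u) (at_right 0))"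

definition step_transition ::
  "'d set \<Rightarrow> (real \<Rightarrow> 'x \<Rightarrow> 'u \<Rightarrow> 'd \<Rightarrow> 'x::real_normed_vector) \<Rightarrow> ('x \<Rightarrow> 'u \<Rightarrow> 'd \<Rightarrow> 'x) \<Rightarrow> bool" where
  "step_transition \<Omega> f fc \<longleftrightarrow>
     (\<forall>x u. uniform_limit \<Omega> (\<lambda>h \<xi>. (f h x u \<xi> - x) /\<^sub>R h) (fc x u) (at_right 0))"

lemma step_reward_Euler: "step_reward (\<lambda>h x u. h * rc x u) rc"
proof -
  have "\<forall>\<^sub>F h in at_right 0. rc x u = h * rc x u / h" for x u
    by (auto simp: eventually_at_filter)
  then show ?thesis
    unfolding step_reward_def by (blast intro: Lim_transform_eventually[OF tendsto_const])
qed

lemma step_transition_Euler: "step_transition \<Omega> (\<lambda>h x u \<xi>. x + h *\<^sub>R fc x u \<xi>) fc"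
  unfolding step_transition_def uniform_limit_iff
  by (auto simp: eventually_at_filter)

text \<open>The value iteration target is the supremum over \<open>u\<close> of \<open>worst_case_return\<close>.\<close>

definition step_return ::
  "(real \<Rightarrow> 'x \<Rightarrow> 'u \<Rightarrow> real) \<Rightarrow> (real \<Rightarrow> 'x \<Rightarrow> 'u \<Rightarrow> 'd \<Rightarrow> 'x) \<Rightarrow> real \<Rightarrow> ('x \<Rightarrow> real)
     \<Rightarrow> real \<Rightarrow> 'x \<Rightarrow> 'u \<Rightarrow> 'd \<Rightarrow> real" where
  "step_return r f \<rho> V h x u \<xi> = r h x u + exp (- \<rho> * h) * V (f h x u \<xi>)"

definition worst_case_return ::
  "'d set \<Rightarrow> (real \<Rightarrow> 'x \<Rightarrow> 'u \<Rightarrow> real) \<Rightarrow> (real \<Rightarrow> 'x \<Rightarrow> 'u \<Rightarrow> 'd \<Rightarrow> 'x) \<Rightarrow> real \<Rightarrow> ('x \<Rightarrow> real)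
     \<Rightarrow> real \<Rightarrow> 'x \<Rightarrow> 'u \<Rightarrow> real" where
  "worst_case_return \<Omega> r f \<rho> V h x u = (INF \<xi>\<in>\<Omega>. step_return r f \<rho> V h x u \<xi>)"

text \<open>For \<open>h\<close> tending to 0 every return tends to \<open>V x\<close>.  The continuous-time limit of the max-min
  problem is therefore taken after subtracting \<open>V x\<close> and dividing by \<open>h\<close>; this does not change the
  maximizers and minimizers of the problem for time step \<open>h\<close>.\<close>

definition ct_optimal_action ::
  "'d set \<Rightarrow> (real \<Rightarrow> 'x \<Rightarrow> 'u \<Rightarrow> real) \<Rightarrow> (real \<Rightarrow> 'x \<Rightarrow> 'u \<Rightarrow> 'd \<Rightarrow> 'x) \<Rightarrow> real \<Rightarrow> ('x \<Rightarrow> real)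
     \<Rightarrow> 'x \<Rightarrow> 'u \<Rightarrow> bool" where
  "ct_optimal_action \<Omega> r f \<rho> V x u \<longleftrightarrow>
     (\<exists>W. (\<forall>v. ((\<lambda>h. (worst_case_return \<Omega> r f \<rho> V h x v - V x) / h) \<longlongrightarrow> W v) (at_right 0)) \<and>
          is_arg_max W (\<lambda>_. True) u)"

definition ct_worst_disturbance ::
  "'d set \<Rightarrow> (real \<Rightarrow> 'x \<Rightarrow> 'u \<Rightarrow> real) \<Rightarrow> (real \<Rightarrow> 'x \<Rightarrow> 'u \<Rightarrow> 'd \<Rightarrow> 'x) \<Rightarrow> real \<Rightarrow> ('x \<Rightarrow> real)
     \<Rightarrow> 'x \<Rightarrow> 'u \<Rightarrow> 'd \<Rightarrow> bool" where
  "ct_worst_disturbance \<Omega> r f \<rho> V x u \<xi> \<longleftrightarrow>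
     (\<exists>L. (\<forall>\<zeta>\<in>\<Omega>. ((\<lambda>h. (step_return r f \<rho> V h x u \<zeta> - V x) / h) \<longlongrightarrow> L \<zeta>) (at_right 0)) \<and>
          is_arg_min L (\<lambda>\<zeta>. \<zeta> \<in> \<Omega>) \<xi>)"

text \<open>Optimal stationary Markovian policy, and optimal disturbance at state \<open>x\<close> against the
  policy \<open>\<pi>\<close>.\<close>

definition ct_optimal_policy ::
  "'d set \<Rightarrow> (real \<Rightarrow> 'x \<Rightarrow> 'u \<Rightarrow> real) \<Rightarrow> (real \<Rightarrow> 'x \<Rightarrow> 'u \<Rightarrow> 'd \<Rightarrow> 'x) \<Rightarrow> real \<Rightarrow> ('x \<Rightarrow> real)
     \<Rightarrow> ('x \<Rightarrow> 'u) \<Rightarrow> bool" where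
  "ct_optimal_policy \<Omega> r f \<rho> V \<pi> \<longleftrightarrow> (\<forall>x. ct_optimal_action \<Omega> r f \<rho> V x (\<pi> x))"

definition energy_ball :: "real \<Rightarrow> 'a::real_normed_vector set" where
  "energy_ball \<alpha> = {\<xi>. norm \<xi> \<le> \<alpha>}"

end

theory Submission
  imports Defs
begin

text \<open>After subtracting \<open>V x\<close> and dividing by \<open>h\<close>, the step return converges, uniformly over the
  bounded set of disturbances, to the affine function
  \<open>q x - g u + (a + B u + \<xi>) \<bullet> \<nabla>V - \<rho> V x\<close> of \<open>\<xi>\<close>, so the infimum over \<open>\<xi>\<close> commutes with the limit.
  By Cauchy-Schwarz the minimizer over the ball is \<open>- \<alpha> \<nabla>V / |\<nabla>V|\<close>, whatever the action. What
  remains is to maximize \<open>w \<bullet> u - g u\<close> with \<open>w = B\<^sup>T \<nabla>V\<close>. Its unique maximizer is \<open>(\<nabla>g)\<^sup>-\<^sup>1 w\<close>, which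
  depends continuously on \<open>w\<close> by strict convexity; hence it is the gradient of the conjugate at \<open>w\<close>.\<close>

section \<open>Gradients\<close>

lemma GDERIV_gradient_eq:
  fixes f :: "'a::real_inner \<Rightarrow> real"
  assumes "GDERIV f x :> D"
  shows "gradient f x = D"
  unfolding gradient_def
proof (rule the_equality)
  fix E
  assume "GDERIV f x :> E"
  with assms have "(\<lambda>h. h \<bullet> E) = (\<lambda>h. h \<bullet> D)"
    unfolding gderiv_def by (rule has_derivative_unique[rotated])
  then show "E = D"
    using vector_eq_ldot[of E D] by (simp add: fun_eq_iff)
qed (fact assms)

text \<open>Riesz representation in finite dimension: the adjoint of the derivative, applied to
  \<open>1\<close>, is the vector that represents it.\<close>

lemma differentiable_imp_GDERIV_gradient:
  fixes f :: "'a::euclidean_space \<Rightarrow> real"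
  assumes "f differentiable (at x)"
  shows "GDERIV f x :> gradient f x"
proof -
  obtain f' where f': "(f has_derivative f') (at x)"
    using assms by (auto simp: differentiable_def)
  have "f' h = h \<bullet> adjoint f' 1" for h
    using adjoint_works[OF has_derivative_linear[OF f'], of h 1] by simp
  then have "f' = (\<lambda>h. h \<bullet> adjoint f' 1)"
    by auto
  then have "GDERIV f x :> adjoint f' 1"
    using f' by (simp add: gderiv_def)
  then show ?thesis
    by (simp add: GDERIV_gradient_eq)
qed

section \<open>The conjugate of a strictly convex function\<close>

lemma strictly_convex_imp_convex_on:
  assumes "strictly_convex g"
  shows "convex_on UNIV g"
proof (rule convex_onI)
  fix t :: real and x y
  assume "0 < t" "t < 1"
  then show "g ((1 - t) *\<^sub>R x + t *\<^sub>R y) \<le> (1 - t) * g x + t * g y"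
    using assms unfolding strictly_convex_def
    by (cases "x = y") (auto simp: algebra_simps scaleR_left_distrib[symmetric] less_imp_le)
qed auto

text \<open>Restricting \<open>g\<close> to the line through \<open>u\<close> and \<open>v\<close>
  reduces this to the tangent inequality for convex functions of one real variable.\<close>

lemma convex_on_GDERIV_above_tangent:
  fixes g :: "'a::real_inner \<Rightarrow> real"
  assumes "convex_on UNIV g" and "GDERIV g u :> w"
  shows "g v \<ge> g u + w \<bullet> (v - u)"
proof -
  let ?\<phi> = "\<lambda>t. g (u + t *\<^sub>R (v - u))"
  have "convex_on UNIV ?\<phi>"
  proof (rule convex_onI)
    fix t x y :: real
    assume "0 < t" "t < 1"
    have "u + ((1 - t) *\<^sub>R x + t *\<^sub>R y) *\<^sub>R (v - u)
        = (1 - t) *\<^sub>R (u + x *\<^sub>R (v - u)) + t *\<^sub>R (u + y *\<^sub>R (v - u))"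
      by (simp add: algebra_simps)
    then show "?\<phi> ((1 - t) *\<^sub>R x + t *\<^sub>R y) \<le> (1 - t) * ?\<phi> x + t * ?\<phi> y"
      using convex_onD[OF assms(1), of t] \<open>0 < t\<close> \<open>t < 1\<close> by simp
  qed auto
  moreover have "(?\<phi> has_field_derivative (w \<bullet> (v - u))) (at 0)"
  proof -
    have "((\<lambda>t. u + t *\<^sub>R (v - u)) has_derivative (\<lambda>t. t *\<^sub>R (v - u))) (at (0::real))"
      by (auto intro!: derivative_eq_intros)
    moreover have "(g has_derivative (\<lambda>h. h \<bullet> w)) (at (u + 0 *\<^sub>R (v - u)))"
      using assms(2) by (simp add: gderiv_def)
    ultimately have "(?\<phi> has_derivative (\<lambda>t. (t *\<^sub>R (v - u)) \<bullet> w)) (at 0)"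
      by (rule has_derivative_compose)
    then show ?thesis
      by (simp add: has_field_derivative_def mult.commute inner_commute mult_commute_abs)
  qed
  ultimately have "?\<phi> 1 - ?\<phi> 0 \<ge> (w \<bullet> (v - u)) * (1 - 0)"
    by (intro convex_on_imp_above_tangent[where A = UNIV]) auto
  then show ?thesis
    by simp
qed

text \<open>At the midpoint the weak tangent inequality bounds \<open>g\<close> from below and
  strict convexity bounds it strictly from above; comparing the two gives strictness at
  \<open>v\<close>.\<close>

lemma strictly_convex_above_tangent:
  fixes g :: "'a::real_inner \<Rightarrow> real"
  assumes g: "strictly_convex g" and "GDERIV g u :> w" and "v \<noteq> u"
  shows "g v > g u + w \<bullet> (v - u)"
proof -
  define t :: real where "t = 1/2"
  define m where "m = (1 - t) *\<^sub>R u + t *\<^sub>R v"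
  have t: "0 < t" "t < 1"
    by (simp_all add: t_def)
  have "m - u = t *\<^sub>R (v - u)"
    by (simp add: m_def algebra_simps)
  then have "g u + t * (w \<bullet> (v - u)) \<le> g m"
    using convex_on_GDERIV_above_tangent[OF strictly_convex_imp_convex_on[OF g] assms(2), of m] by simp
  also have "g m < (1 - t) * g u + t * g v"
    using g \<open>v \<noteq> u\<close> t unfolding strictly_convex_def m_def by (metis (full_types))
  finally have "t * (g u + w \<bullet> (v - u)) < t * g v"
    by (simp add: algebra_simps)
  then show ?thesis
    using t by simp
qed

text \<open>The tangent inequality at \<open>u\<close> says exactly that \<open>u\<close> attains
  the supremum, so the real-valued \<open>SUP\<close> is a genuine maximum.\<close>

lemma convex_conjugate_GDERIV:
  fixes g :: "'a::real_inner \<Rightarrow> real"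
  assumes "convex_on UNIV g" and "GDERIV g u :> w"
  shows "convex_conjugate g w = w \<bullet> u - g u"
proof -
  have "w \<bullet> v - g v \<le> w \<bullet> u - g u" for v
    using convex_on_GDERIV_above_tangent[OF assms, of v] by (simp add: inner_diff_right)
  then show ?thesis
    unfolding convex_conjugate_def by (intro cSup_eq_maximum) auto
qed

text \<open>By compactness, \<open>g\<close> lies above its tangent at \<open>u0\<close> by a fixed margin on a sphere around \<open>u0\<close>, so
  a small tilt keeps the minimizer of the tilted function inside the sphere.\<close>

lemma tendsto_inverse_gradient:
  fixes g :: "'a::euclidean_space \<Rightarrow> real"
  assumes g: "strictly_convex g"
    and k: "\<And>w. GDERIV g (k w) :> w"
    and cont: "continuous_on UNIV g"
  shows "(k \<longlongrightarrow> k w0) (nhds w0)"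
proof (rule tendstoI)
  fix e :: real
  assume e: "e > 0"
  define u0 where "u0 = k w0"
  define G where "G v = g v - g u0 - w0 \<bullet> (v - u0)" for v
  have "continuous_on (sphere u0 e) G"
    unfolding G_def by (intro continuous_intros continuous_on_subset[OF cont]) auto
  moreover have "sphere u0 e \<noteq> {}"
    using e by simp
  ultimately obtain v0 where v0: "v0 \<in> sphere u0 e" "\<And>v. v \<in> sphere u0 e \<Longrightarrow> G v0 \<le> G v"
    using continuous_attains_inf[OF compact_sphere, of u0 e G] by auto
  have "v0 \<noteq> u0"
    using v0(1) e by auto
  then have pos: "G v0 > 0"
    using strictly_convex_above_tangent[OF g k[of w0], of v0] by (simp add: G_def u0_def)
  \<comment> \<open>The radius \<open>G v0 / e\<close> is chosen so that changing the slope from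
    \<open>w0\<close> to \<open>w\<close> costs less than the margin \<open>G v0\<close> at distance
    \<open>e\<close>.\<close>
  have close: "dist (k w) u0 < e" if w: "dist w w0 < G v0 / e" for w
  proof (rule ccontr)
    assume far: "\<not> dist (k w) u0 < e"
    define d where "d = k w - u0"
    have nd: "norm d \<ge> e"
      using far by (simp add: d_def dist_norm)
    then have nd0: "norm d > 0"
      using e by linarith
    \<comment> \<open>With this \<open>t\<close>, \<open>v\<close> is the point where the segment
      from \<open>u0\<close> to \<open>k w\<close> crosses the sphere.\<close>
    define t where "t = e / norm d"
    define v where "v = (1 - t) *\<^sub>R u0 + t *\<^sub>R k w"
    have t: "0 < t" "t \<le> 1"
      using e nd nd0 by (auto simp: t_def)
    have v: "v - u0 = t *\<^sub>R d"
      by (simp add: v_def d_def algebra_simps)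
    then have nv: "norm (v - u0) = e"
      using nd0 e by (simp add: t_def)
    then have "v \<in> sphere u0 e"
      by (simp add: dist_norm norm_minus_commute)
    then have "G v0 \<le> G v"
      by (rule v0(2))
    moreover have "(w - w0) \<bullet> (v - u0) < G v0"
    proof -
      have "(w - w0) \<bullet> (v - u0) \<le> norm (w - w0) * e"
        using norm_cauchy_schwarz[of "w - w0" "v - u0"] nv by simp
      also have "\<dots> < G v0"
        using w e by (simp add: dist_norm pos_less_divide_eq)
      finally show ?thesis .
    qed
    ultimately have "w \<bullet> (v - u0) < g v - g u0"
      by (simp add: G_def inner_diff_left)
    moreover have "g v \<le> (1 - t) * g u0 + t * g (k w)"
      unfolding v_def using convex_onD[OF strictly_convex_imp_convex_on[OF g], of t u0 "k w"] t by simp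
    \<comment> \<open>The tilted function \<open>g - w \<bullet> _\<close> is minimal at
      \<open>k w\<close>, so by convexity its value at \<open>v\<close> cannot exceed its value at
      \<open>u0\<close>, contrary to the previous strict inequality.\<close>
    moreover have "g (k w) - w \<bullet> d \<le> g u0"
      using convex_on_GDERIV_above_tangent[OF strictly_convex_imp_convex_on[OF g] k[of w], of u0]
      by (simp add: d_def inner_diff_right)
    then have "t * (g (k w) - w \<bullet> d) \<le> t * g u0"
      using t by (intro mult_left_mono) auto
    ultimately show False
      by (simp add: v algebra_simps)
  qed
  have "eventually (\<lambda>w. dist w w0 < G v0 / e) (nhds w0)"
    unfolding eventually_nhds_metric using pos e by (intro exI[of _ "G v0 / e"]) auto
  then show "eventually (\<lambda>w. dist (k w) (k w0) < e) (nhds w0)"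
    by eventually_elim (use close u0_def in auto)
qed

text \<open>Testing the supremum defining the conjugate at \<open>w\<close> with the maximizer at \<open>w'\<close>, and vice versa,
  bounds the remainder of the linear approximation by \<open>|w' - w| |k w' - k w|\<close>.\<close>

lemma GDERIV_convex_conjugate:
  fixes g :: "'a::euclidean_space \<Rightarrow> real"
  assumes g: "strictly_convex g"
    and k: "\<And>w. GDERIV g (k w) :> w"
    and cont: "continuous_on UNIV g"
  shows "GDERIV (convex_conjugate g) w :> k w"
proof -
  have cv: "convex_on UNIV g"
    by (rule strictly_convex_imp_convex_on[OF g])
  have conj: "convex_conjugate g w = w \<bullet> k w - g (k w)" for w
    by (rule convex_conjugate_GDERIV[OF cv k])
  have tangent: "g v \<ge> g (k w) + w \<bullet> (v - k w)" for v w
    by (rule convex_on_GDERIV_above_tangent[OF cv k])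
  have bound: "norm (convex_conjugate g y - convex_conjugate g w - (y - w) \<bullet> k w)
      \<le> dist (k y) (k w) * norm (y - w)" for y
  proof -
    have "0 \<le> convex_conjugate g y - convex_conjugate g w - (y - w) \<bullet> k w"
      using tangent[of y "k w"] by (simp add: conj inner_diff_left inner_diff_right)
    moreover have "convex_conjugate g y - convex_conjugate g w - (y - w) \<bullet> k w
        \<le> (y - w) \<bullet> (k y - k w)"
      using tangent[of w "k y"] by (simp add: conj inner_diff_left inner_diff_right)
    moreover have "(y - w) \<bullet> (k y - k w) \<le> norm (y - w) * norm (k y - k w)"
      by (rule norm_cauchy_schwarz)
    ultimately show ?thesis
      by (simp add: dist_norm mult.commute)
  qed
  show ?thesis
    unfolding gderiv_def has_derivative_at_alt
  proof (intro conjI allI impI)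
    show "bounded_linear (\<lambda>h. h \<bullet> k w)"
      by (rule bounded_linear_inner_left)
    fix e :: real
    assume "e > 0"
    with tendsto_inverse_gradient[OF assms] have "\<forall>\<^sub>F y in nhds w. dist (k y) (k w) < e"
      by (rule tendstoD)
    then obtain d where d: "d > 0" "\<And>y. dist y w < d \<Longrightarrow> dist (k y) (k w) < e"
      unfolding eventually_nhds_metric by auto
    show "\<exists>d>0. \<forall>y. norm (y - w) < d \<longrightarrow>
        norm (convex_conjugate g y - convex_conjugate g w - (y - w) \<bullet> k w) \<le> e * norm (y - w)"
    proof (intro exI conjI allI impI)
      fix y
      assume "norm (y - w) < d"
      then have "dist (k y) (k w) * norm (y - w) \<le> e * norm (y - w)"
        using d(2)[of y] by (intro mult_right_mono) (auto simp: dist_norm)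
      then show "norm (convex_conjugate g y - convex_conjugate g w - (y - w) \<bullet> k w) \<le> e * norm (y - w)"
        using bound[of y] by linarith
    qed (fact d(1))
  qed
qed

section \<open>First-order expansion of the step return\<close>

text \<open>A chain rule uniform in \<open>s\<close>: boundedness of \<open>b\<close> makes
  \<open>y h s - x\<close> of order \<open>h\<close> uniformly, so the Taylor remainder
  \<open>R\<close> is uniformly \<open>o(h)\<close> and only the linear part survives.\<close>

lemma uniform_limit_GDERIV_quotient:
  fixes V :: "'a::real_inner \<Rightarrow> real"
  assumes V: "GDERIV V x :> D"
    and y: "uniform_limit S (\<lambda>h s. (y h s - x) /\<^sub>R h) b (at_right 0)"
    and b: "bounded (b ` S)"
  shows "uniform_limit S (\<lambda>h s. (V (y h s) - V x) / h) (\<lambda>s. b s \<bullet> D) (at_right 0)"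
proof -
  define R where "R z = V z - V x - (z - x) \<bullet> D" for z
  have "uniform_limit S (\<lambda>h s. R (y h s) / h) (\<lambda>s. 0) (at_right 0)"
  proof (rule uniform_limitI)
    fix e :: real
    assume e: "e > 0"
    obtain M where M: "M > 0" "\<And>s. s \<in> S \<Longrightarrow> norm (b s) \<le> M"
      using b by (auto simp: bounded_pos)
    \<comment> \<open>The quotients eventually stay within 1 of \<open>b s\<close>, hence have norm
      at most \<open>K\<close>. The factor \<open>e / (2 * K)\<close> below then bounds the
      remainder by \<open>e * h / 2\<close>.\<close>
    define K where "K = M + 1"
    have K: "K > 0"
      using M by (simp add: K_def)
    obtain d where d: "d > 0" "\<And>z. norm (z - x) < d \<Longrightarrow> norm (R z) \<le> e / (2 * K) * norm (z - x)"
      using V e K unfolding gderiv_def has_derivative_at_alt R_def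
      by (metis divide_pos_pos mult_pos_pos zero_less_numeral)
    have "\<forall>\<^sub>F h in at_right 0. \<forall>s\<in>S. dist ((y h s - x) /\<^sub>R h) (b s) < 1"
      using y by (auto simp: uniform_limit_iff)
    moreover have "\<forall>\<^sub>F h in at_right 0. h \<in> {0<..<d / K}"
      using d(1) K by (intro eventually_at_right_real) simp
    ultimately show "\<forall>\<^sub>F h in at_right 0. \<forall>s\<in>S. dist (R (y h s) / h) 0 < e"
    proof eventually_elim
      case (elim h)
      show ?case
      proof
        fix s
        assume s: "s \<in> S"
        have h: "h > 0" "h * K < d"
          using elim(2) K by (auto simp: pos_less_divide_eq)
        have "norm ((y h s - x) /\<^sub>R h) \<le> norm (b s) + dist ((y h s - x) /\<^sub>R h) (b s)"
          by (metis add.commute diff_add_cancel dist_norm norm_triangle_ineq)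
        then have "norm ((y h s - x) /\<^sub>R h) \<le> K"
          using elim(1) s M(2)[OF s] unfolding K_def by fastforce
        then have "inverse h * norm (y h s - x) \<le> K"
          using h(1) by simp
        then have yK: "norm (y h s - x) \<le> h * K"
          using h(1) by (simp add: field_simps)
        then have "norm (R (y h s)) \<le> e / (2 * K) * norm (y h s - x)"
          using d(2) h(2) by simp
        also have "\<dots> \<le> e / (2 * K) * (h * K)"
          using yK e K by (intro mult_left_mono) auto
        also have "\<dots> < e * h"
          using K e h(1) by (simp add: field_simps)
        finally show "dist (R (y h s) / h) 0 < e"
          using h(1) by (simp add: pos_divide_less_eq)
      qed
    qed
  qed
  moreover have "R (y h s) / h + ((y h s - x) /\<^sub>R h) \<bullet> D = (V (y h s) - V x) / h" for h s
    unfolding R_def inner_scaleR_left divide_inverse by (simp add: algebra_simps)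
  ultimately show ?thesis
    using uniform_limit_add[OF _ bounded_linear.uniform_limit[OF bounded_linear_inner_left y, of D]]
    by fastforce
qed

lemma tendsto_imp_uniform_limit:
  assumes "(f \<longlongrightarrow> l) F"
  shows "uniform_limit S (\<lambda>h s. f h) (\<lambda>s. l) F"
proof (rule uniform_limitI)
  fix e :: real
  assume "0 < e"
  with assms have "\<forall>\<^sub>F h in F. dist (f h) l < e"
    by (rule tendstoD)
  then show "\<forall>\<^sub>F h in F. \<forall>s\<in>S. dist (f h) l < e"
    by eventually_elim simp
qed

text \<open>The quotient splits into \<open>r / h\<close>,
  \<open>(exp (- \<rho> * h) - 1) / h * V x\<close> and the discounted difference quotient of
  \<open>V\<close>. The second term yields \<open>- \<rho> * V x\<close>; boundedness of
  \<open>fc\<close> lets the product in the third converge uniformly.\<close>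

lemma uniform_limit_step_return:
  fixes fc :: "'x::real_inner \<Rightarrow> 'u \<Rightarrow> 'd \<Rightarrow> 'x"
  assumes r: "step_reward r rc" and f: "step_transition S f fc"
    and V: "GDERIV V x :> D" and bdd: "bounded (fc x u ` S)"
  shows "uniform_limit S (\<lambda>h \<xi>. (step_return r f \<rho> V h x u \<xi> - V x) / h)
      (\<lambda>\<xi>. rc x u + fc x u \<xi> \<bullet> D - \<rho> * V x) (at_right 0)"
proof -
  have "uniform_limit S (\<lambda>h \<xi>. (V (f h x u \<xi>) - V x) / h) (\<lambda>\<xi>. fc x u \<xi> \<bullet> D) (at_right 0)"
    using f unfolding step_transition_def by (intro uniform_limit_GDERIV_quotient V bdd) auto
  moreover have "((\<lambda>h. exp (- \<rho> * h)) \<longlongrightarrow> exp (- \<rho> * 0)) (at_right 0)"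
    by (intro tendsto_intros)
  then have "((\<lambda>h. exp (- \<rho> * h)) \<longlongrightarrow> 1) (at_right 0)"
    by simp
  moreover have "bounded ((\<lambda>\<xi>. fc x u \<xi> \<bullet> D) ` S)"
    using bounded_linear_image[OF bdd bounded_linear_inner_left[of D]] by (simp add: image_image)
  moreover have "bounded ((\<lambda>_. 1 :: real) ` S)"
    by (rule boundedI[of _ 1]) auto
  ultimately have 1: "uniform_limit S (\<lambda>h \<xi>. exp (- \<rho> * h) * ((V (f h x u \<xi>) - V x) / h))
      (\<lambda>\<xi>. 1 * (fc x u \<xi> \<bullet> D)) (at_right 0)"
    by (intro uniform_lim_mult tendsto_imp_uniform_limit)
  have "((\<lambda>h. exp (- \<rho> * h)) has_field_derivative - \<rho>) (at 0)"
    by (auto intro!: derivative_eq_intros)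
  then have "((\<lambda>h. (exp (- \<rho> * h) - 1) / h) \<longlongrightarrow> - \<rho>) (at_right 0)"
    unfolding DERIV_def by (auto intro: tendsto_mono[OF at_le])
  moreover have "((\<lambda>h. r h x u / h) \<longlongrightarrow> rc x u) (at_right 0)"
    using r by (simp add: step_reward_def)
  ultimately have "((\<lambda>h. r h x u / h + (exp (- \<rho> * h) - 1) / h * V x) \<longlongrightarrow> rc x u + - \<rho> * V x)
      (at_right 0)"
    by (intro tendsto_intros)
  from uniform_limit_add[OF tendsto_imp_uniform_limit[OF this] 1]
  show ?thesis
    by (simp add: step_return_def algebra_simps add_divide_distrib diff_divide_distrib)
qed

text \<open>Once the uniform error is below \<open>e / 2\<close>, every quotient is at least
  \<open>F \<xi>0 - e / 2\<close> and the one at \<open>\<xi>0\<close> is below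
  \<open>F \<xi>0 + e / 2\<close>; the infimum inherits both bounds.\<close>

lemma tendsto_INF_quotient:
  fixes s :: "real \<Rightarrow> 'd \<Rightarrow> real"
  assumes lim: "uniform_limit S (\<lambda>h \<xi>. (s h \<xi> - v) / h) F (at_right 0)"
    and min: "\<xi>0 \<in> S" "\<And>\<xi>. \<xi> \<in> S \<Longrightarrow> F \<xi>0 \<le> F \<xi>"
  shows "((\<lambda>h. ((INF \<xi>\<in>S. s h \<xi>) - v) / h) \<longlongrightarrow> F \<xi>0) (at_right 0)"
proof (rule tendstoI)
  fix e :: real
  assume e: "e > 0"
  then have "\<forall>\<^sub>F h in at_right 0. \<forall>\<xi>\<in>S. dist ((s h \<xi> - v) / h) (F \<xi>) < e / 2"
    using lim unfolding uniform_limit_iff by (meson half_gt_zero)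
  then show "\<forall>\<^sub>F h in at_right 0. dist (((INF \<xi>\<in>S. s h \<xi>) - v) / h) (F \<xi>0) < e"
    using eventually_at_right_less[of "0::real"]
  proof eventually_elim
    case (elim h)
    \<comment> \<open>This also bounds the returns from below, so that the real \<open>INF\<close>
      is a genuine infimum.\<close>
    have lower: "v + h * (F \<xi>0 - e / 2) \<le> s h \<xi>" if "\<xi> \<in> S" for \<xi>
    proof -
      have "F \<xi>0 - e / 2 \<le> (s h \<xi> - v) / h"
        using bspec[OF elim(1) that] min(2)[OF that] unfolding dist_real_def by linarith
      then show ?thesis
        using elim(2) by (simp add: pos_le_divide_eq mult.commute)
    qed
    have "v + h * (F \<xi>0 - e / 2) \<le> (INF \<xi>\<in>S. s h \<xi>)"
      using min(1) lower by (intro cINF_greatest) auto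
    then have "F \<xi>0 - e / 2 \<le> ((INF \<xi>\<in>S. s h \<xi>) - v) / h"
      using elim(2) by (simp add: pos_le_divide_eq mult.commute)
    moreover have "(INF \<xi>\<in>S. s h \<xi>) \<le> s h \<xi>0"
      using min(1) lower by (intro cINF_lower bdd_belowI2) auto
    then have "((INF \<xi>\<in>S. s h \<xi>) - v) / h \<le> (s h \<xi>0 - v) / h"
      using elim(2) by (simp add: divide_right_mono)
    moreover have "(s h \<xi>0 - v) / h < F \<xi>0 + e / 2"
      using bspec[OF elim(1) min(1)] unfolding dist_real_def by linarith
    ultimately show ?case
      using e by (simp add: dist_real_def abs_less_iff)
  qed
qed

section \<open>Optimality in the continuous-time limit\<close>

text \<open>One-sided limits at 0 are unique, so the existentially quantified objective can only be
  \<open>W\<close>.\<close>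

lemma ct_optimal_action_iff:
  assumes "\<And>v. ((\<lambda>h. (worst_case_return \<Omega> r f \<rho> V h x v - V x) / h) \<longlongrightarrow> W v) (at_right 0)"
  shows "ct_optimal_action \<Omega> r f \<rho> V x u \<longleftrightarrow> (\<forall>v. W v \<le> W u)"
proof -
  have "W' = W"
    if "\<And>v. ((\<lambda>h. (worst_case_return \<Omega> r f \<rho> V h x v - V x) / h) \<longlongrightarrow> W' v) (at_right 0)" for W'
    using that assms by (intro ext tendsto_unique[OF trivial_limit_at_right_real])
  then show ?thesis
    unfolding ct_optimal_action_def is_arg_max_linorder using assms by auto
qed

lemma ct_worst_disturbance_iff:
  assumes "\<And>\<zeta>. \<zeta> \<in> \<Omega> \<Longrightarrow>
      ((\<lambda>h. (step_return r f \<rho> V h x u \<zeta> - V x) / h) \<longlongrightarrow> L \<zeta>) (at_right 0)"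
  shows "ct_worst_disturbance \<Omega> r f \<rho> V x u \<xi> \<longleftrightarrow> \<xi> \<in> \<Omega> \<and> (\<forall>\<zeta>\<in>\<Omega>. L \<xi> \<le> L \<zeta>)"
proof
  assume "ct_worst_disturbance \<Omega> r f \<rho> V x u \<xi>"
  then obtain L' where
    L': "\<And>\<zeta>. \<zeta> \<in> \<Omega> \<Longrightarrow> ((\<lambda>h. (step_return r f \<rho> V h x u \<zeta> - V x) / h) \<longlongrightarrow> L' \<zeta>) (at_right 0)"
    and min: "\<xi> \<in> \<Omega>" "\<And>\<zeta>. \<zeta> \<in> \<Omega> \<Longrightarrow> L' \<xi> \<le> L' \<zeta>"
    unfolding ct_worst_disturbance_def is_arg_min_linorder by auto
  \<comment> \<open>The limits determine the objective only on \<open>\<Omega>\<close>, which is all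
    that the minimization sees.\<close>
  have "L' \<zeta> = L \<zeta>" if "\<zeta> \<in> \<Omega>" for \<zeta>
    by (rule tendsto_unique[OF trivial_limit_at_right_real L'[OF that] assms[OF that]])
  then show "\<xi> \<in> \<Omega> \<and> (\<forall>\<zeta>\<in>\<Omega>. L \<xi> \<le> L \<zeta>)"
    using min by simp
next
  assume "\<xi> \<in> \<Omega> \<and> (\<forall>\<zeta>\<in>\<Omega>. L \<xi> \<le> L \<zeta>)"
  then show "ct_worst_disturbance \<Omega> r f \<rho> V x u \<xi>"
    unfolding ct_worst_disturbance_def is_arg_min_linorder using assms by (intro exI[of _ L]) simp
qed

lemma inner_ge_on_energy_ball:
  fixes D \<xi> :: "'a::real_inner"
  assumes "\<xi> \<in> energy_ball \<alpha>"
  shows "- \<alpha> * norm D \<le> \<xi> \<bullet> D"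
proof -
  have "- (\<xi> \<bullet> D) \<le> norm \<xi> * norm D"
    using norm_cauchy_schwarz[of "- \<xi>" D] by simp
  also have "\<dots> \<le> \<alpha> * norm D"
    using assms by (intro mult_right_mono) (auto simp: energy_ball_def)
  finally show ?thesis
    by simp
qed

text \<open>For \<open>D = 0\<close> the vector below is \<open>0\<close>, as division by zero yields zero.\<close>

lemma inner_min_on_energy_ball:
  fixes D :: "'a::real_inner"
  assumes "0 \<le> \<alpha>"
  defines "\<xi>0 \<equiv> - \<alpha> *\<^sub>R (D /\<^sub>R norm D)"
  shows "\<xi>0 \<in> energy_ball \<alpha>" and "\<xi>0 \<bullet> D = - \<alpha> * norm D"
proof -
  have "norm \<xi>0 \<le> \<alpha>"
    using \<open>0 \<le> \<alpha>\<close> by (cases "D = 0") (simp_all add: \<xi>0_def mult.assoc)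
  then show "\<xi>0 \<in> energy_ball \<alpha>"
    by (simp add: energy_ball_def)
  show "\<xi>0 \<bullet> D = - \<alpha> * norm D"
    by (cases "D = 0") (simp_all add: \<xi>0_def dot_square_norm power2_eq_square)
qed

text \<open>The equality case of Cauchy-Schwarz: for the unit vector \<open>e\<close> along
  \<open>D\<close>, the squared norm of \<open>\<xi> + \<alpha> *\<^sub>R e\<close> is at most
  \<open>\<alpha>^2 - 2 * \<alpha>^2 + \<alpha>^2 = 0\<close>.\<close>

lemma inner_min_on_energy_ball_unique:
  fixes D \<xi> :: "'a::real_inner"
  assumes \<xi>: "\<xi> \<in> energy_ball \<alpha>" "\<xi> \<bullet> D \<le> - \<alpha> * norm D" and "D \<noteq> 0"
  shows "\<xi> = - \<alpha> *\<^sub>R (D /\<^sub>R norm D)"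
proof -
  define e where "e = D /\<^sub>R norm D"
  have e: "e \<bullet> e = 1"
    using \<open>D \<noteq> 0\<close> by (simp add: e_def dot_square_norm power2_eq_square)
  have "\<xi> \<bullet> e \<le> - \<alpha>"
    using \<xi>(2) \<open>D \<noteq> 0\<close> by (simp add: e_def field_simps)
  moreover have n: "norm \<xi> \<le> \<alpha>"
    using \<xi>(1) by (simp add: energy_ball_def)
  then have "\<alpha> \<ge> 0"
    using norm_ge_zero order_trans by blast
  ultimately have "\<alpha> * (\<xi> \<bullet> e) \<le> \<alpha> * (- \<alpha>)"
    by (intro mult_left_mono)
  moreover have "\<xi> \<bullet> \<xi> \<le> \<alpha> * \<alpha>"
    using n mult_mono[OF n n] \<open>\<alpha> \<ge> 0\<close> by (simp add: dot_square_norm power2_eq_square)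
  moreover have "(\<xi> + \<alpha> *\<^sub>R e) \<bullet> (\<xi> + \<alpha> *\<^sub>R e) = \<xi> \<bullet> \<xi> + 2 * (\<alpha> * (\<xi> \<bullet> e)) + \<alpha> * \<alpha>"
    by (simp add: inner_add_left inner_add_right inner_commute e algebra_simps)
  ultimately have "(\<xi> + \<alpha> *\<^sub>R e) \<bullet> (\<xi> + \<alpha> *\<^sub>R e) \<le> 0"
    by linarith
  then have "\<xi> + \<alpha> *\<^sub>R e = 0"
    by (metis inner_ge_zero inner_eq_zero_iff antisym)
  then show ?thesis
    by (simp add: e_def eq_neg_iff_add_eq_0)
qed

theorem theorem1:
  fixes a :: "real ^ 'n \<Rightarrow> 'p \<Rightarrow> real ^ 'n"
    and B :: "real ^ 'n \<Rightarrow> 'p \<Rightarrow> real ^ 'm ^ 'n"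
    and \<theta> :: 'p
    and q :: "real ^ 'n \<Rightarrow> real"
    and g :: "real ^ 'm \<Rightarrow> real"
    and V :: "real ^ 'n \<Rightarrow> real"
    and \<rho> \<alpha> :: real
    and r :: "real \<Rightarrow> real ^ 'n \<Rightarrow> real ^ 'm \<Rightarrow> real"
    and f :: "real \<Rightarrow> real ^ 'n \<Rightarrow> real ^ 'm \<Rightarrow> real ^ 'n \<Rightarrow> real ^ 'n"
  assumes "0 < \<rho>"
    and "0 \<le> \<alpha>"
    and "strictly_convex g"
    and "positive_definite g"
    and "\<And>u. g differentiable (at u)"
    and "bij (gradient g)"
    and "\<And>x. V differentiable (at x)"
    and "step_reward r (\<lambda>x u. q x - g u)"
    and "step_transition (energy_ball \<alpha>) f (\<lambda>x u \<xi>. a x \<theta> + B x \<theta> *v u + \<xi>)"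
  shows "(\<exists>\<pi>. ct_optimal_policy (energy_ball \<alpha>) r f \<rho> V \<pi>) \<and>
    (\<forall>\<pi>. ct_optimal_policy (energy_ball \<alpha>) r f \<rho> V \<pi> \<longrightarrow>
       (\<forall>x. \<pi> x = gradient (convex_conjugate g) (transpose (B x \<theta>) *v gradient V x) \<and>
            (gradient V x \<noteq> 0 \<longrightarrow>
              (\<forall>\<xi>. ct_worst_disturbance (energy_ball \<alpha>) r f \<rho> V x (\<pi> x) \<xi> \<longleftrightarrow>
                   \<xi> = - \<alpha> *\<^sub>R (gradient V x /\<^sub>R norm (gradient V x))))))"
proof -
  let ?fc = "\<lambda>x u \<xi>. a x \<theta> + B x \<theta> *v u + \<xi>"
  let ?\<Omega> = "energy_ball \<alpha> :: (real ^ 'n) set"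
  define D where "D = gradient V"
  define w where "w x = transpose (B x \<theta>) *v D x" for x
  define k where "k = inv (gradient g)"
  define \<xi>0 where "\<xi>0 x = - \<alpha> *\<^sub>R (D x /\<^sub>R norm (D x))" for x
  define L where "L x u \<xi> = q x - g u + ?fc x u \<xi> \<bullet> D x - \<rho> * V x" for x u \<xi>
  have \<xi>0_in: "\<xi>0 x \<in> ?\<Omega>" for x
    unfolding \<xi>0_def by (rule inner_min_on_energy_ball(1)[OF \<open>0 \<le> \<alpha>\<close>])
  have \<xi>0_inner: "\<xi>0 x \<bullet> D x = - \<alpha> * norm (D x)" for x
    unfolding \<xi>0_def by (rule inner_min_on_energy_ball(2)[OF \<open>0 \<le> \<alpha>\<close>])
  have L: "uniform_limit ?\<Omega> (\<lambda>h \<xi>. (step_return r f \<rho> V h x u \<xi> - V x) / h) (L x u) (at_right 0)" for x u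
  proof -
    have "bounded (?fc x u ` ?\<Omega>)"
      unfolding energy_ball_def
      by (intro bounded_translation boundedI[of _ \<alpha>]) auto
    from uniform_limit_step_return[OF assms(8,9) differentiable_imp_GDERIV_gradient[OF assms(7)] this]
    show ?thesis
      by (simp add: L_def[abs_def] D_def)
  qed
  \<comment> \<open>The disturbance enters the limit objective only through its inner product with
    \<open>D x\<close>, so one minimizer serves all actions.\<close>
  have L_diff: "L x u \<xi> - L x u \<zeta> = \<xi> \<bullet> D x - \<zeta> \<bullet> D x" for x u \<xi> \<zeta>
    by (simp add: L_def inner_add_left)
  have L_min: "L x u (\<xi>0 x) \<le> L x u \<xi>" if "\<xi> \<in> ?\<Omega>" for x u \<xi>
    using inner_ge_on_energy_ball[OF that, of "D x"] \<xi>0_inner[of x] L_diff[of x u "\<xi>0 x" \<xi>]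
    by linarith
  have W: "((\<lambda>h. (worst_case_return ?\<Omega> r f \<rho> V h x u - V x) / h) \<longlongrightarrow> L x u (\<xi>0 x)) (at_right 0)" for x u
    unfolding worst_case_return_def by (rule tendsto_INF_quotient[OF L \<xi>0_in L_min])
  have w: "(B x \<theta> *v u) \<bullet> D x = w x \<bullet> u" for x u
    by (subst inner_commute) (simp add: w_def dot_lmul_matrix)
  \<comment> \<open>The last two summands collect everything independent of \<open>u\<close>,
    leaving the objective of the conjugate at \<open>w x\<close>.\<close>
  have L_action: "L x u (\<xi>0 x) = w x \<bullet> u - g u + L x 0 (\<xi>0 x) + g 0" for x u
    by (simp add: L_def inner_add_left w)
  \<comment> \<open>Since \<open>gradient g\<close> is onto, every slope \<open>v\<close> is
    attained, namely at \<open>k v\<close>.\<close>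
  have g_deriv: "GDERIV g (k v) :> v" for v
    using differentiable_imp_GDERIV_gradient[OF assms(5), of "k v"] surj_f_inv_f[OF bij_is_surj[OF assms(6)]]
    by (simp add: k_def)
  \<comment> \<open>Strictness makes \<open>k (w x)\<close> the only maximizer; this gives both
    existence of an optimal policy and the formula for every such policy.\<close>
  have optimal: "ct_optimal_action ?\<Omega> r f \<rho> V x u \<longleftrightarrow> u = k (w x)" for x u
  proof -
    have strict: "w x \<bullet> v - g v < w x \<bullet> k (w x) - g (k (w x))" if "v \<noteq> k (w x)" for v
      using strictly_convex_above_tangent[OF assms(3) g_deriv[of "w x"] that] by (simp add: inner_diff_right)
    have "ct_optimal_action ?\<Omega> r f \<rho> V x u \<longleftrightarrow> (\<forall>v. w x \<bullet> v - g v \<le> w x \<bullet> u - g u)"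
      unfolding ct_optimal_action_iff[of ?\<Omega> r f \<rho> V x "\<lambda>u. L x u (\<xi>0 x)", OF W]
      by (subst (1 2) L_action) simp
    then show ?thesis
      using strict by (metis leD less_imp_le order_refl)
  qed
  have "continuous_on UNIV g"
    using assms(5) by (intro continuous_at_imp_continuous_on ballI differentiable_imp_continuous_within)
  then have k: "gradient (convex_conjugate g) v = k v" for v
    by (intro GDERIV_gradient_eq GDERIV_convex_conjugate[OF assms(3) g_deriv])
  \<comment> \<open>If \<open>D x = 0\<close>, the objective is constant on the ball and every
    admissible disturbance is a minimizer; hence the restriction.\<close>
  have disturbance: "ct_worst_disturbance ?\<Omega> r f \<rho> V x u \<xi> \<longleftrightarrow> \<xi> = \<xi>0 x" if "D x \<noteq> 0" for x u \<xi>
  proof -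
    have "ct_worst_disturbance ?\<Omega> r f \<rho> V x u \<xi> \<longleftrightarrow> \<xi> \<in> ?\<Omega> \<and> (\<forall>\<zeta>\<in>?\<Omega>. L x u \<xi> \<le> L x u \<zeta>)"
      by (rule ct_worst_disturbance_iff) (rule tendsto_uniform_limitI[OF L])
    moreover have "\<xi> = \<xi>0 x" if "\<xi> \<in> ?\<Omega>" "L x u \<xi> \<le> L x u (\<xi>0 x)"
    proof -
      have "\<xi> \<bullet> D x \<le> - \<alpha> * norm (D x)"
        using that(2) \<xi>0_inner[of x] L_diff[of x u \<xi> "\<xi>0 x"] by linarith
      then show ?thesis
        unfolding \<xi>0_def using that(1) \<open>D x \<noteq> 0\<close> by (intro inner_min_on_energy_ball_unique)
    qed
    ultimately show ?thesis
      using \<xi>0_in L_min by blast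
  qed
  show ?thesis
    using optimal disturbance k
    by (auto simp: ct_optimal_policy_def w_def D_def \<xi>0_def)
qed

end
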